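(* Let $p,q\in[1,\infty]$ with $\frac1p+\frac1q=1$ and let $d,N\in\mathbb{N}$. For every $N$-element point set $\mathcal{P}=\{\boldsymbol{x}_1,\ldots,\boldsymbol{x}_N\}\subset[0,1)^d$ and all real weights $\mathcal{A}=\{a_1,\ldots,a_N\}$, the worst-case integration error in $F_{d,q}^{\rm per}$ equals the periodic $L_p$-discrepancy: $$e(Q_{\mathcal{P},\mathcal{A}};F_{d,q}^{\rm per})=L_{p,N}^{\rm per}(\mathcal{P},\mathcal{A}).$$ In particular, $e(N,d;F_{d,q}^{\rm per})={\rm disc}_p^{\rm per}(N,d)$.
   Context: Periodic boxes. For $x,y\in[0,1]$ set $I(x,y):=[x,y)$ if $x\le y$ and $I(x,y):=[0,y)\cup[x,1)$ if $x>y$. For $\boldsymbol{x},\boldsymbol{y}\in[0,1]^d$ set $B(\boldsymbol{x},\boldsymbol{y}):=I(x_1,y_1)\times\cdots\times I(x_d,y_d)$. Discrepancy. With $\lambda$ the Lebesgue measure, put $\Delta_{\mathcal{P},\mathcal{A}}(C):=\sum_{k=1}^Na_k\mathbf{1}_C(\boldsymbol{x}_k)-\lambda(C)$ for measurable $C\subseteq[0,1)^d$. The periodic $L_p$-discrepancy is $$L_{p,N}^{\rm per}(\mathcal{P},\mathcal{A}):=\|(\boldsymbol{x},\boldsymbol{y})\mapsto\Delta_{\mathcal{P},\mathcal{A}}(B(\boldsymbol{x},\boldsymbol{y}))\|_{L_p([0,1]^{2d})},$$ and ${\rm disc}_p^{\rm per}(N,d):=\inf_{\mathcal{P},\mathcal{A}}L_{p,N}^{\rm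 per}(\mathcal{P},\mathcal{A})$, the infimum being over all $N$-element sets $\mathcal{P}\subset[0,1)^d$ and all real weights $\mathcal{A}$. Function space. For $c\in L_q([0,1]^{2d})$ define the function $T_d^{\rm per}c$ on $[0,1]^d$ by $$(T_d^{\rm per}c)(\boldsymbol{t}):=\int_{[0,1]^{2d}}c(\boldsymbol{x},\boldsymbol{y})\,\mathbf{1}_{B(\boldsymbol{x},\boldsymbol{y})}(\boldsymbol{t})\,{\rm d}(\boldsymbol{x},\boldsymbol{y}).$$ Let $F_{d,q}^{\rm per}:=\{T_d^{\rm per}c:\ c\in L_q([0,1]^{2d})\}$ with norm $$\|f\|_{F_{d,q}^{\rm per}}:=\inf\{\|c\|_{L_q([0,1]^{2d})}:\ c\in L_q([0,1]^{2d}),\ f=T_d^{\rm per}c\}.$$ Integration. For functions $f$ on $[0,1]^d$ let $\int f:=\int_{[0,1]^d}f(\boldsymbol{t})\,{\rm d}\boldsymbol{t}$ and $Q_{\mathcal{P},\mathcal{A}}(f):=\sum_{k=1}^Na_kf(\boldsymbol{x}_k)$; the worst-case error is $$e(Q_{\mathcal{P},\mathcal{A}};F_{d,q}^{\rm per}):=\sup_{f\in F_{d,q}^{\rm per},\ \|f\|_{F_{d,q}^{\rm per}}\le1}\left|\int f-Q_{\mathcal{P},\mathcal{A}}(f)\right|.$$ The $N$-th minimal error $e(N,d;F_{d,q}^{\rm per})$ is the infimum of $e(Q_{\mathcal{P},\mathcal{A}};F_{d,q}^{\rm per})$ over all $N$-element sets $\mathcal{P}\subset[0,1)^d$ and all real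 weights $\mathcal{A}$. *)

theory Defs
  imports "HOL-Analysis.Analysis" "HOL-Probability.Essential_Supremum"
begin

section \<open>\<open>L\<^sub>p\<close> norms for exponents in \<open>[1,\<infinity>]\<close>\<close>

text \<open>
  Norms, errors and discrepancies take values in \<^typ>\<open>ennreal\<close>, so that all infima and suprema
  below are taken in a complete lattice.  There is no power with real exponents on \<^typ>\<open>ennreal\<close>,
  hence the case distinction for the \<open>p\<close>-th root.  Elements of \<open>L\<^sub>p\<close> are represented by functions
  rather than by classes of functions modulo equality almost everywhere.
\<close>

definition Lp_norm :: "ennreal \<Rightarrow> 'a measure \<Rightarrow> ('a \<Rightarrow> real) \<Rightarrow> ennreal" where
  "Lp_norm p M f =
    (if p = \<infinity> then esssup M (\<lambda>z. ennreal \<bar>f z\<bar>)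
     else let J = (\<integral>\<^sup>+ z. ennreal (\<bar>f z\<bar> powr enn2real p) \<partial>M)
          in if J = \<infinity> then \<infinity> else ennreal (enn2real J powr (1 / enn2real p)))"

definition Lp_space :: "ennreal \<Rightarrow> 'a measure \<Rightarrow> ('a \<Rightarrow> real) set" where
  "Lp_space p M = {f. f \<in> borel_measurable M \<and> Lp_norm p M f < \<infinity>}"


section \<open>Periodic boxes\<close>

text \<open>The dimension \<open>d \<ge> 1\<close> is the cardinality of the finite index type \<^typ>\<open>'d\<close>.\<close>

definition unit_cube :: "(real ^ 'd::finite) set" where
  "unit_cube = {t. \<forall>i. t $ i \<in> {0..1}}"

definition half_open_unit_cube :: "(real ^ 'd::finite) set" where
  "half_open_unit_cube = {t. \<forall>i. t $ i \<in> {0..<1}}"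

definition per_interval :: "real \<Rightarrow> real \<Rightarrow> real set" where
  "per_interval x y = (if x \<le> y then {x..<y} else {0..<y} \<union> {x..<1})"

definition per_box :: "real ^ 'd::finite \<Rightarrow> real ^ 'd \<Rightarrow> (real ^ 'd) set" where
  "per_box x y = {t. \<forall>i. t $ i \<in> per_interval (x $ i) (y $ i)}"

abbreviation cube_measure :: "(real ^ 'd::finite) measure" where
  "cube_measure \<equiv> lebesgue_on unit_cube"

abbreviation double_cube_measure :: "((real ^ 'd::finite) \<times> (real ^ 'd)) measure" where
  "double_cube_measure \<equiv> lebesgue_on (unit_cube \<times> unit_cube)"


section \<open>Point sets and periodic discrepancy\<close>

text \<open>
  An \<open>N\<close>-element point set \<open>{x\<^sub>1, \<dots>, x\<^sub>N}\<close> is given by an injective enumeration, and the weights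
  by \<open>a\<^sub>1, \<dots>, a\<^sub>N\<close>; values of \<open>x\<close> and \<open>a\<close> at indices outside \<open>{1..N}\<close> are never used.
\<close>

definition point_sets :: "nat \<Rightarrow> (nat \<Rightarrow> real ^ 'd::finite) set" where
  "point_sets N = {x. inj_on x {1..N} \<and> x ` {1..N} \<subseteq> half_open_unit_cube}"

definition local_discrepancy ::
    "nat \<Rightarrow> (nat \<Rightarrow> real ^ 'd::finite) \<Rightarrow> (nat \<Rightarrow> real) \<Rightarrow> (real ^ 'd) set \<Rightarrow> real" where
  "local_discrepancy N x a C = (\<Sum>k=1..N. a k * indicator C (x k)) - measure lebesgue C"

definition per_discrepancy ::
    "ennreal \<Rightarrow> nat \<Rightarrow> (nat \<Rightarrow> real ^ 'd::finite) \<Rightarrow> (nat \<Rightarrow> real) \<Rightarrow> ennreal" where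
  "per_discrepancy p N x a =
    Lp_norm p double_cube_measure (\<lambda>(u, v). local_discrepancy N x a (per_box u v))"

definition min_per_discrepancy :: "'d::finite itself \<Rightarrow> ennreal \<Rightarrow> nat \<Rightarrow> ennreal" where
  "min_per_discrepancy _ p N =
    (INF (x, a) \<in> (point_sets N :: (nat \<Rightarrow> real ^ 'd) set) \<times> UNIV. per_discrepancy p N x a)"


section \<open>The function space and numerical integration\<close>

text \<open>
  Periodic boxes with corners in the closed cube lie in the half-open cube, so \<open>T_per c\<close>
  vanishes off \<^const>\<open>unit_cube\<close>.  Functions on the cube are thus represented by their extension by
  zero, and equality as total functions is equality on the cube.
\<close>

definition T_per :: "((real ^ 'd::finite) \<times> (real ^ 'd) \<Rightarrow> real) \<Rightarrow> real ^ 'd \<Rightarrow> real" where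
  "T_per c t =
    (\<integral>z. c z * indicator (per_box (fst z) (snd z)) t \<partial>double_cube_measure)"

definition F_per :: "ennreal \<Rightarrow> (real ^ 'd::finite \<Rightarrow> real) set" where
  "F_per q = T_per ` Lp_space q double_cube_measure"

definition F_per_norm :: "ennreal \<Rightarrow> (real ^ 'd::finite \<Rightarrow> real) \<Rightarrow> ennreal" where
  "F_per_norm q f =
    (INF c \<in> {c \<in> Lp_space q double_cube_measure. f = T_per c}. Lp_norm q double_cube_measure c)"

definition quadrature ::
    "nat \<Rightarrow> (nat \<Rightarrow> real ^ 'd::finite) \<Rightarrow> (nat \<Rightarrow> real) \<Rightarrow> (real ^ 'd \<Rightarrow> real) \<Rightarrow> real" where
  "quadrature N x a f = (\<Sum>k=1..N. a k * f (x k))"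

definition worst_case_error ::
    "ennreal \<Rightarrow> nat \<Rightarrow> (nat \<Rightarrow> real ^ 'd::finite) \<Rightarrow> (nat \<Rightarrow> real) \<Rightarrow> ennreal" where
  "worst_case_error q N x a =
    (SUP f \<in> {f \<in> F_per q. F_per_norm q f \<le> 1}.
      ennreal \<bar>(\<integral>t. f t \<partial>cube_measure) - quadrature N x a f\<bar>)"

definition min_worst_case_error :: "'d::finite itself \<Rightarrow> ennreal \<Rightarrow> nat \<Rightarrow> ennreal" where
  "min_worst_case_error _ q N =
    (INF (x, a) \<in> (point_sets N :: (nat \<Rightarrow> real ^ 'd) set) \<times> UNIV. worst_case_error q N x a)"

end

theory Submission
  imports Defs
begin

text \<open>
  By Fubini, the quadrature error of \<open>T_per c\<close> is \<open>-\<integral> c(x,y) \<Delta>(B(x,y)) d(x,y)\<close>, the pairing of \<open>c\<close>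
  with the local discrepancy \<open>\<Delta>\<close>.  The worst-case error is therefore the norm of the functional on
  \<open>L\<^sub>q\<close> given by \<open>\<Delta>\<close>: Hoelder's inequality bounds it by the \<open>L\<^sub>p\<close> norm of \<open>\<Delta>\<close>, and the usual
  extremal \<open>c\<close> (for \<open>p = \<infinity>\<close> a normalised indicator of a set where \<open>\<bar>\<Delta>\<bar>\<close> is nearly maximal) shows that the
  bound is sharp.
\<close>

section \<open>Hoelder's inequality and duality\<close>

lemma Lp_space_ennreal_iff:
  assumes "0 < P"
  shows "f \<in> Lp_space (ennreal P) M \<longleftrightarrow>
    f \<in> borel_measurable M \<and> integrable M (\<lambda>z. \<bar>f z\<bar> powr P)"
proof -
  have "Lp_norm (ennreal P) M f < \<infinity> \<longleftrightarrow> (\<integral>\<^sup>+ z. ennreal (\<bar>f z\<bar> powr P) \<partial>M) < \<infinity>"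
    using assms by (auto simp: Lp_norm_def Let_def top.not_eq_extremum)
  then show ?thesis
    by (auto simp: Lp_space_def integrable_iff_bounded)
qed

lemma Lp_norm_ennreal:
  assumes "0 < P" "integrable M (\<lambda>z. \<bar>f z\<bar> powr P)"
  shows "Lp_norm (ennreal P) M f = ennreal ((\<integral>z. \<bar>f z\<bar> powr P \<partial>M) powr (1 / P))"
  using assms by (simp add: Lp_norm_def Let_def nn_integral_eq_integral)

lemma Lp_space_infinityE:
  assumes "f \<in> Lp_space \<infinity> M"
  obtains K where "0 \<le> K" "Lp_norm \<infinity> M f = ennreal K" "AE z in M. \<bar>f z\<bar> \<le> K"
    "f \<in> borel_measurable M"
proof -
  have "Lp_norm \<infinity> M f < \<infinity>" and m: "f \<in> borel_measurable M"
    using assms by (auto simp: Lp_space_def)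
  then obtain K where K: "0 \<le> K" "Lp_norm \<infinity> M f = ennreal K"
    by (cases "Lp_norm \<infinity> M f") auto
  have "AE z in M. ennreal \<bar>f z\<bar> \<le> Lp_norm \<infinity> M f"
    using esssup_AE by (auto simp: Lp_norm_def)
  then have "AE z in M. \<bar>f z\<bar> \<le> K"
    using K by simp
  with K m that show thesis by blast
qed

lemma Lp_norm_infinity_le:
  assumes "f \<in> borel_measurable M" "AE z in M. \<bar>f z\<bar> \<le> K"
  shows "Lp_norm \<infinity> M f \<le> ennreal K"
  unfolding Lp_norm_def using assms by (auto intro!: esssup_I ennreal_leI elim!: eventually_mono)

lemma ennreal_lessD: "ennreal a < ennreal b \<Longrightarrow> a < b"
  using ennreal_leI[of b a] by (meson leD leI)

text \<open>Since \<open>1 / \<infinity> = 0\<close>, an infinite exponent forces the other one to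
  be \<open>1\<close>. If both are finite, neither can be \<open>1\<close>, because the reciprocal
  of the other is positive.\<close>

lemma conjugate_exponents_cases:
  fixes p q :: ennreal
  assumes "1 \<le> p" "1 \<le> q" "1 / p + 1 / q = 1"
  obtains (one_infinity) "p = 1" "q = \<infinity>"
  | (infinity_one) "p = \<infinity>" "q = 1"
  | (real) P Q :: real where "p = ennreal P" "q = ennreal Q" "1 < P" "1 < Q" "1 / P + 1 / Q = 1"
proof (cases p)
  case top
  then have "1 / q = 1" using assms by simp
  then have "q = 1" using assms(2)
    by (cases q) (auto simp: divide_ennreal simp flip: ennreal_1)
  with top infinity_one show ?thesis by simp
next
  case p: (real P)
  then have P: "1 \<le> P" using assms(1) by (simp flip: ennreal_1)
  show ?thesis
  proof (cases q)
    case top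
    then have "1 / p = 1" using assms by simp
    then have "P = 1" using P p
      by (auto simp: divide_ennreal simp flip: ennreal_1)
    with top p one_infinity show ?thesis by simp
  next
    case q: (real Q)
    then have Q: "1 \<le> Q" using assms(2) by (simp flip: ennreal_1)
    have "ennreal (1 / P + 1 / Q) = ennreal 1"
      using assms(3) p q P Q by (simp add: divide_ennreal flip: ennreal_1 ennreal_plus)
    then have eq: "1 / P + 1 / Q = 1"
      using P Q by (subst (asm) ennreal_inj) auto
    then have "P \<noteq> 1" "Q \<noteq> 1" using P Q by auto
    with P Q eq real p q show ?thesis by fastforce
  qed
qed

text \<open>For the exponents \<open>1\<close> and \<open>\<infinity>\<close> the essential bound of
  one factor is pulled out of the integral. Otherwise Young's inequality, applied pointwise to the
  factors divided by their norms, is integrated.\<close>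

lemma Lp_space_Holder:
  fixes f g :: "'a \<Rightarrow> real"
  assumes pq: "1 \<le> p" "1 \<le> q" "1 / p + 1 / q = 1"
    and f: "f \<in> Lp_space p M" and g: "g \<in> Lp_space q M"
  shows "integrable M (\<lambda>z. f z * g z)" (is ?int)
    and "ennreal \<bar>\<integral>z. f z * g z \<partial>M\<bar> \<le> Lp_norm p M f * Lp_norm q M g" (is ?le)
proof -
  \<comment> \<open>Stated for fresh \<open>f\<close> and \<open>g\<close>, so that it covers both
    endpoint pairs, the second with the two functions exchanged.\<close>
  have 1: "integrable M (\<lambda>z. f z * g z) \<and>
      ennreal \<bar>\<integral>z. f z * g z \<partial>M\<bar> \<le> Lp_norm 1 M f * Lp_norm \<infinity> M g"
    if f: "f \<in> Lp_space 1 M" and g: "g \<in> Lp_space \<infinity> M" for f g :: "'a \<Rightarrow> real"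
  proof -
    have "f \<in> borel_measurable M \<and> integrable M (\<lambda>z. \<bar>f z\<bar>)"
      using f Lp_space_ennreal_iff[of 1 f M] by simp
    then have mf[measurable]: "f \<in> borel_measurable M" and if1: "integrable M (\<lambda>z. \<bar>f z\<bar>)"
      by auto
    have nf: "Lp_norm 1 M f = ennreal (\<integral>z. \<bar>f z\<bar> \<partial>M)"
      using Lp_norm_ennreal[of 1 M f] if1 by simp
    obtain K where K: "0 \<le> K" "Lp_norm \<infinity> M g = ennreal K" "AE z in M. \<bar>g z\<bar> \<le> K"
      and [measurable]: "g \<in> borel_measurable M"
      using Lp_space_infinityE[OF g] by metis
    have ae: "AE z in M. \<bar>f z * g z\<bar> \<le> \<bar>f z\<bar> * K"
      using K(3) by eventually_elim (simp add: abs_mult mult_left_mono)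
    have ifK: "integrable M (\<lambda>z. \<bar>f z\<bar> * K)" using if1 by simp
    have i: "integrable M (\<lambda>z. f z * g z)"
      using ae K(1) by (intro Bochner_Integration.integrable_bound[OF ifK]) auto
    have "\<bar>\<integral>z. f z * g z \<partial>M\<bar> \<le> (\<integral>z. \<bar>f z * g z\<bar> \<partial>M)"
      by (rule integral_abs_bound)
    also have "\<dots> \<le> (\<integral>z. \<bar>f z\<bar> * K \<partial>M)"
      by (rule integral_mono_AE) (use i ifK ae in auto)
    also have "\<dots> = (\<integral>z. \<bar>f z\<bar> \<partial>M) * K" by simp
    finally show ?thesis
      using i nf K by (simp add: ennreal_leI flip: ennreal_mult)
  qed
  have "?int \<and> ?le"
    using pq
  proof (cases rule: conjugate_exponents_cases)
    case one_infinity
    then show ?thesis using 1 f g by simp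
  next
    case infinity_one
    then show ?thesis using 1[of g f] f g by (simp add: mult.commute)
  next
    case (real P Q)
    then have pos: "0 < P" "0 < Q" by auto
    have [measurable]: "f \<in> borel_measurable M" "g \<in> borel_measurable M"
      and iP: "integrable M (\<lambda>z. \<bar>f z\<bar> powr P)" and iQ: "integrable M (\<lambda>z. \<bar>g z\<bar> powr Q)"
      using f g Lp_space_ennreal_iff[OF pos(1)] Lp_space_ennreal_iff[OF pos(2)] real by auto
    define A where "A = (\<integral>z. \<bar>f z\<bar> powr P \<partial>M) powr (1 / P)"
    define B where "B = (\<integral>z. \<bar>g z\<bar> powr Q \<partial>M) powr (1 / Q)"
    have AP: "A powr P = (\<integral>z. \<bar>f z\<bar> powr P \<partial>M)" and BQ: "B powr Q = (\<integral>z. \<bar>g z\<bar> powr Q \<partial>M)"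
      using pos by (auto simp: A_def B_def powr_powr)
    have AB: "0 \<le> A" "0 \<le> B" by (auto simp: A_def B_def)
    have norms: "Lp_norm p M f = ennreal A" "Lp_norm q M g = ennreal B"
      using Lp_norm_ennreal[OF pos(1) iP] Lp_norm_ennreal[OF pos(2) iQ] real
      by (auto simp: A_def B_def)
    \<comment> \<open>Young's inequality without normalisation already gives integrability, also
      when one of the norms is zero.\<close>
    have "\<bar>f z * g z\<bar> \<le> \<bar>f z\<bar> powr P / P + \<bar>g z\<bar> powr Q / Q" for z
      using Youngs_inequality[of P Q "\<bar>f z\<bar>" "\<bar>g z\<bar>"] real by (simp add: abs_mult)
    then have "AE z in M. norm (f z * g z) \<le> norm (\<bar>f z\<bar> powr P / P + \<bar>g z\<bar> powr Q / Q)"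
      by (intro AE_I2) (metis abs_ge_self order_trans real_norm_def)
    moreover have "integrable M (\<lambda>z. \<bar>f z\<bar> powr P / P + \<bar>g z\<bar> powr Q / Q)"
      using iP iQ by simp
    ultimately have i: "integrable M (\<lambda>z. f z * g z)"
      by (rule Bochner_Integration.integrable_bound[rotated 2]) simp
    \<comment> \<open>Division by \<open>A * B\<close> is meaningless here; instead one factor
      vanishes almost everywhere.\<close>
    have zero: "(\<integral>z. f z * g z \<partial>M) = 0" if "A = 0 \<or> B = 0"
    proof -
      have "(\<integral>z. \<bar>f z\<bar> powr P \<partial>M) = 0 \<or> (\<integral>z. \<bar>g z\<bar> powr Q \<partial>M) = 0"
        using that pos by (auto simp flip: AP BQ)
      then have "(AE z in M. \<bar>f z\<bar> powr P = 0) \<or> (AE z in M. \<bar>g z\<bar> powr Q = 0)"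
        by (simp only: integral_nonneg_eq_0_iff_AE[OF iP] integral_nonneg_eq_0_iff_AE[OF iQ]
            AE_I2 powr_ge_zero)
      then have "AE z in M. f z * g z = 0"
        by (elim disjE) (erule eventually_mono; simp)+
      then show ?thesis by (rule integral_eq_zero_AE)
    qed
    have "\<bar>\<integral>z. f z * g z \<partial>M\<bar> \<le> A * B"
    proof (cases "A = 0 \<or> B = 0")
      case True
      then show ?thesis using zero by auto
    next
      case False
      then have AB: "0 < A" "0 < B" using AB by auto
      \<comment> \<open>After division by \<open>A\<close> and \<open>B\<close> both factors have
        norm \<open>1\<close>, so the right-hand side integrates to
        \<open>1 / P + 1 / Q = 1\<close>.\<close>
      have young: "\<bar>f z * g z\<bar> / (A * B) \<le>
          \<bar>f z\<bar> powr P / (P * A powr P) + \<bar>g z\<bar> powr Q / (Q * B powr Q)" for z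
        using Youngs_inequality[of P Q "\<bar>f z\<bar> / A" "\<bar>g z\<bar> / B"] real AB
        by (simp add: abs_mult powr_divide mult.commute)
      have "(\<integral>z. \<bar>f z * g z\<bar> \<partial>M) / (A * B) = (\<integral>z. \<bar>f z * g z\<bar> / (A * B) \<partial>M)" by simp
      also have "\<dots> \<le> (\<integral>z. \<bar>f z\<bar> powr P / (P * A powr P) + \<bar>g z\<bar> powr Q / (Q * B powr Q) \<partial>M)"
        using young i iP iQ by (intro integral_mono) auto
      also have "\<dots> = A powr P / (P * A powr P) + B powr Q / (Q * B powr Q)"
        using iP iQ by (simp add: AP BQ)
      also have "\<dots> = 1" using real AB by simp
      finally have "(\<integral>z. \<bar>f z * g z\<bar> \<partial>M) \<le> A * B"
        using AB by (simp add: field_simps)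
      then show ?thesis using integral_abs_bound[of M "\<lambda>z. f z * g z"] by linarith
    qed
    then show ?thesis
      using i norms AB by (simp add: ennreal_leI flip: ennreal_mult)
  qed
  then show ?int ?le by auto
qed

section \<open>Duality over a finite measure\<close>

lemma (in finite_measure) bounded_Lp_space:
  assumes "1 \<le> p" "f \<in> borel_measurable M" "\<And>z. z \<in> space M \<Longrightarrow> \<bar>f z\<bar> \<le> K"
  shows "f \<in> Lp_space p M"
proof (cases p)
  case top
  have "Lp_norm \<infinity> M f \<le> ennreal K"
    by (rule Lp_norm_infinity_le) (use assms in auto)
  then show ?thesis
    using assms top by (auto simp: Lp_space_def le_less_trans[OF _ ennreal_less_top])
next
  case (real P)
  then have P: "1 \<le> P" using assms(1) by (simp flip: ennreal_1)
  have "integrable M (\<lambda>z. \<bar>f z\<bar> powr P)"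
    using assms P by (intro integrable_const_bound[where B="K powr P"]) (auto intro!: powr_mono2)
  then show ?thesis
    using assms P real by (simp add: Lp_space_ennreal_iff)
qed

text \<open>Hoelder's inequality against the constant \<open>1\<close>, which lies in
  \<open>L_q\<close> because the measure is finite.\<close>

lemma (in finite_measure) Lp_space_integrable:
  assumes "1 \<le> p" "1 \<le> q" "1 / p + 1 / q = 1" "f \<in> Lp_space p M"
  shows "integrable M f"
proof -
  have "(\<lambda>_. 1) \<in> Lp_space q M"
    using assms(2) by (rule bounded_Lp_space[where K=1]) auto
  from Lp_space_Holder(1)[OF assms this] show ?thesis by simp
qed

text \<open>This is the sharpness of Hoelder's inequality. For finite \<open>p\<close> the chosen
  \<open>c\<close> attains the norm of \<open>g\<close>; for \<open>p = \<infinity>\<close> the norm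
  need not be attained, so the claim is made for every \<open>s\<close> strictly below it.\<close>

lemma (in finite_measure) Lp_norm_dual:
  assumes pq: "1 \<le> p" "1 \<le> q" "1 / p + 1 / q = 1"
    and g: "g \<in> Lp_space p M" and s: "ennreal s < Lp_norm p M g"
  obtains c where "c \<in> Lp_space q M" "Lp_norm q M c \<le> 1" "s \<le> (\<integral>z. c z * g z \<partial>M)"
  using pq
proof (cases rule: conjugate_exponents_cases)
  case one_infinity
  have "g \<in> borel_measurable M \<and> integrable M (\<lambda>z. \<bar>g z\<bar>)"
    using g one_infinity Lp_space_ennreal_iff[of 1 g M] by simp
  then have [measurable]: "g \<in> borel_measurable M" and i: "integrable M (\<lambda>z. \<bar>g z\<bar>)" by auto
  have "Lp_norm p M g = ennreal (\<integral>z. \<bar>g z\<bar> \<partial>M)"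
    using Lp_norm_ennreal[of 1 M g] i one_infinity by simp
  then have "s \<le> (\<integral>z. \<bar>g z\<bar> \<partial>M)"
    using s ennreal_lessD[of s] by fastforce
  also have "\<dots> = (\<integral>z. sgn (g z) * g z \<partial>M)"
    by (simp add: abs_sgn mult.commute)
  finally have "s \<le> (\<integral>z. sgn (g z) * g z \<partial>M)" .
  moreover have "(\<lambda>z. sgn (g z)) \<in> Lp_space q M"
    using assms(2) by (rule bounded_Lp_space[where K=1]) (auto simp: sgn_if)
  moreover have "Lp_norm q M (\<lambda>z. sgn (g z)) \<le> 1"
    using Lp_norm_infinity_le[of "\<lambda>z. sgn (g z)" M 1] one_infinity by (simp add: sgn_if)
  ultimately show ?thesis using that by blast
next
  case infinity_one
  have [measurable]: "g \<in> borel_measurable M" using g by (simp add: Lp_space_def)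
  \<comment> \<open>\<open>ennreal\<close> sends negative reals to \<open>0\<close>; truncating
    \<open>s\<close> at \<open>0\<close> makes comparison in \<open>ennreal\<close> agree with
    comparison of reals.\<close>
  define s' where "s' = max s 0"
  have "ennreal s' < esssup M (\<lambda>z. ennreal \<bar>g z\<bar>)"
    using s infinity_one by (cases "s \<le> 0") (auto simp: Lp_norm_def s'_def max_def ennreal_neg)
  \<comment> \<open>Any level strictly below the essential supremum is exceeded on a set of positive
    measure. This set, \<open>A\<close>, carries \<open>c\<close>.\<close>
  then have "emeasure M {z \<in> space M. ennreal \<bar>g z\<bar> > ennreal s'} > 0"
    by (intro esssup_pos_measure) auto
  moreover define A where "A = {z \<in> space M. \<bar>g z\<bar> > s'}"
  moreover have "{z \<in> space M. ennreal \<bar>g z\<bar> > ennreal s'} = A"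
    by (simp add: A_def s'_def ennreal_less_iff)
  ultimately have A: "measure M A > 0"
    by (simp add: emeasure_eq_measure)
  have [measurable]: "A \<in> sets M" by (simp add: A_def)
  define c where "c z = sgn (g z) * indicator A z / measure M A" for z
  have [measurable]: "c \<in> borel_measurable M" unfolding c_def[abs_def] by measurable
  \<comment> \<open>On \<open>A\<close> the value of \<open>g\<close> is nonzero because
    \<open>s'\<close> is nonnegative, so its sign has modulus \<open>1\<close>.\<close>
  have c: "\<bar>c z\<bar> = indicator A z / measure M A" if "z \<in> space M" for z
    using A that by (auto simp: c_def A_def s'_def sgn_if split: split_indicator)
  have iA: "integrable M (indicator A :: 'a \<Rightarrow> real)"
    by (intro integrable_real_indicator) (simp_all add: emeasure_eq_measure)
  then have ic: "integrable M (\<lambda>z. \<bar>c z\<bar>)"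
    by (subst Bochner_Integration.integrable_cong[OF refl c]) auto
  have "(\<integral>z. \<bar>c z\<bar> \<partial>M) = 1"
    using A by (subst Bochner_Integration.integral_cong[OF refl c]) auto
  then have "Lp_norm q M c \<le> 1"
    using Lp_norm_ennreal[of 1 M c] ic infinity_one by simp
  moreover have cq: "c \<in> Lp_space q M"
    using Lp_space_ennreal_iff[of 1 c M] ic infinity_one by simp
  moreover have "s \<le> (\<integral>z. c z * g z \<partial>M)"
  proof -
    have "s \<le> (\<integral>z. s' * (indicator A z / measure M A) \<partial>M)"
      using A by (simp add: s'_def)
    also have "\<dots> \<le> (\<integral>z. c z * g z \<partial>M)"
    proof (rule integral_mono)
      show "integrable M (\<lambda>z. s' * (indicator A z / measure M A))"
        using iA by simp
      show "integrable M (\<lambda>z. c z * g z)"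
        using Lp_space_Holder(1)[OF pq g cq] by (simp add: mult.commute)
      show "s' * (indicator A z / measure M A) \<le> c z * g z" for z
      proof -
        have "c z * g z = \<bar>g z\<bar> * (indicator A z / measure M A)"
          by (simp add: c_def abs_sgn)
        moreover have "s' * indicator A z \<le> \<bar>g z\<bar> * indicator A z"
          by (auto simp: A_def split: split_indicator)
        ultimately show ?thesis by (simp add: divide_right_mono)
      qed
    qed
    finally show ?thesis .
  qed
  ultimately show ?thesis using that by blast
next
  case (real P Q)
  then have pos: "0 < P" "0 < Q" by auto
  have [measurable]: "g \<in> borel_measurable M" and iP: "integrable M (\<lambda>z. \<bar>g z\<bar> powr P)"
    using g Lp_space_ennreal_iff[OF pos(1)] real by auto
  define n where "n = (\<integral>z. \<bar>g z\<bar> powr P \<partial>M) powr (1 / P)"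
  have nP: "n powr P = (\<integral>z. \<bar>g z\<bar> powr P \<partial>M)"
    using pos by (simp add: n_def powr_powr)
  have "Lp_norm p M g = ennreal n"
    using Lp_norm_ennreal[OF pos(1) iP] real by (simp add: n_def)
  then have sn: "s \<le> n" "0 < n"
    using s ennreal_lessD[of s n] by (auto simp: n_def intro!: ccontr[of "0 < _"])
  have PQ: "(P - 1) * Q = P" using real by (simp add: field_simps)
  \<comment> \<open>The equality case of Hoelder's inequality: by \<open>(P - 1) * Q = P\<close> the
    \<open>Q\<close>-th power of its modulus is \<open>\<bar>g z\<bar> powr P / n powr P\<close>,
    with integral \<open>1\<close>, and its pairing with \<open>g\<close> is
    \<open>n powr P / n powr (P - 1) = n\<close>.\<close>
  define c where "c z = sgn (g z) * (\<bar>g z\<bar> / n) powr (P - 1)" for z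
  have [measurable]: "c \<in> borel_measurable M" unfolding c_def[abs_def] by measurable
  have cQ: "\<bar>c z\<bar> powr Q = \<bar>g z\<bar> powr P / n powr P" for z
    using sn by (auto simp: c_def abs_mult sgn_if powr_powr PQ powr_divide)
  have cg: "c z * g z = \<bar>g z\<bar> powr P / n powr (P - 1)" for z
    using sn by (auto simp: c_def sgn_if powr_divide powr_diff)
  have iQ: "integrable M (\<lambda>z. \<bar>c z\<bar> powr Q)" using iP by (simp add: cQ)
  have "(\<integral>z. \<bar>c z\<bar> powr Q \<partial>M) = 1" using sn by (simp add: cQ flip: nP)
  then have "Lp_norm q M c \<le> 1"
    using Lp_norm_ennreal[OF pos(2) iQ] real by simp
  moreover have "c \<in> Lp_space q M"
    using iQ real by (simp add: Lp_space_ennreal_iff[OF pos(2)])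
  moreover have "s \<le> (\<integral>z. c z * g z \<partial>M)"
    using sn by (simp add: cg powr_diff flip: nP)
  ultimately show ?thesis using that by blast
qed

section \<open>Integration over periodic boxes\<close>

lemma mem_per_interval_iff:
  "t \<in> per_interval x y \<longleftrightarrow>
    (x \<le> y \<and> x \<le> t \<and> t < y) \<or> (y < x \<and> (0 \<le> t \<and> t < y \<or> x \<le> t \<and> t < 1))"
  by (auto simp: per_interval_def)

text \<open>Membership is a conjunction over finitely many coordinates of Boolean combinations of
  order comparisons. Letting both corners and the point vary gives the joint measurability that
  Fubini requires.\<close>

lemma pred_per_box [measurable (raw)]:
  fixes f g h :: "'a \<Rightarrow> real ^ 'd::finite"
  assumes [measurable]: "f \<in> borel_measurable M" "g \<in> borel_measurable M" "h \<in> borel_measurable M"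
  shows "Measurable.pred M (\<lambda>w. h w \<in> per_box (f w) (g w))"
proof -
  have [measurable]: "(\<lambda>w. f w $ i) \<in> borel_measurable M" "(\<lambda>w. g w $ i) \<in> borel_measurable M"
      "(\<lambda>w. h w $ i) \<in> borel_measurable M" for i
    using assms[THEN measurable_compose, OF borel_measurable_nth] by auto
  show ?thesis
    unfolding per_box_def mem_per_interval_iff mem_Collect_eq by measurable
qed

lemma sets_unit_cube [measurable]: "(unit_cube :: (real ^ 'd::finite) set) \<in> sets borel"
  unfolding unit_cube_def by measurable

lemma emeasure_unit_cube_finite: "emeasure lborel (unit_cube :: (real ^ 'd::finite) set) < \<infinity>"
proof -
  have "unit_cube = cbox 0 (1 :: real ^ 'd)"
    by (auto simp: unit_cube_def mem_box_cart)
  then show ?thesis using emeasure_bounded_finite[OF bounded_cbox] by metis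
qed

lemma per_box_subset_unit_cube:
  assumes "x \<in> unit_cube" "y \<in> unit_cube"
  shows "per_box x y \<subseteq> unit_cube"
proof
  fix t assume "t \<in> per_box x y"
  then have "t $ i \<in> per_interval (x $ i) (y $ i)" for i by (simp add: per_box_def)
  moreover have "x $ i \<in> {0..1}" "y $ i \<in> {0..1}" for i
    using assms by (auto simp: unit_cube_def)
  ultimately have "t $ i \<in> {0..1}" for i
    using mem_per_interval_iff[of "t $ i" "x $ i" "y $ i"] by (smt (verit) atLeastAtMost_iff)
  then show "t \<in> unit_cube" by (simp add: unit_cube_def)
qed

lemma double_cube_sets [measurable]:
  "(unit_cube \<times> unit_cube :: ((real ^ 'd::finite) \<times> (real ^ 'd)) set) \<in> sets borel"
  using pair_measureI[OF sets_unit_cube[where 'd='d] sets_unit_cube[where 'd='d]]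
  by (simp only: borel_prod)

lemma finite_measure_double_cube:
  "finite_measure (double_cube_measure :: ((real ^ 'd::finite) \<times> (real ^ 'd)) measure)"
proof -
  have "emeasure lborel (unit_cube \<times> unit_cube :: ((real ^ 'd) \<times> (real ^ 'd)) set) < \<infinity>"
    using emeasure_unit_cube_finite[where 'd='d]
    by (subst lborel_prod[symmetric], subst lborel.emeasure_pair_measure_Times)
      (auto intro: ennreal_mult_less_top[THEN iffD2])
  then show ?thesis
    by (intro finite_measureI) (simp add: emeasure_restrict_space)
qed

section \<open>Borel representatives and Fubini's theorem\<close>

lemma integral_lebesgue_on_borel:
  fixes f :: "'a::euclidean_space \<Rightarrow> real"
  assumes [measurable]: "S \<in> sets borel" "f \<in> borel_measurable borel"
  shows "(\<integral>z. f z \<partial>lebesgue_on S) = (\<integral>z. indicator S z * f z \<partial>lborel)"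
  by (simp add: integral_restrict_space integral_completion)

text \<open>
  Lebesgue measure on a product space is the completion of \<^const>\<open>lborel\<close> and not the product of
  Lebesgue measures, so Fubini applies only after passing to a Borel function.
\<close>
lemma borel_representative:
  fixes c :: "'a::euclidean_space \<Rightarrow> real"
  assumes [measurable]: "S \<in> sets borel" and c: "integrable (lebesgue_on S) c"
  obtains b where "integrable lborel b" "AE z in lborel. indicator S z * c z = b z"
    "\<And>g. g \<in> borel_measurable borel \<Longrightarrow>
      (\<integral>z. c z * g z \<partial>lebesgue_on S) = (\<integral>z. b z * g z \<partial>lborel)"
proof -
  have ic: "integrable lebesgue (\<lambda>z. indicator S z * c z)"
    using c by (simp add: integrable_restrict_space)
  then have mc: "(\<lambda>z. indicator S z * c z) \<in> borel_measurable lebesgue" by auto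
  \<comment> \<open>A function measurable for the completion agrees almost everywhere with a Borel
    function. Representing \<open>c\<close> cut off to \<open>S\<close> turns integrals over
    \<open>S\<close> into integrals over the whole space.\<close>
  then obtain b where [measurable]: "b \<in> borel_measurable lborel"
    and ae: "AE z in lborel. indicator S z * c z = b z"
    using completion_ex_borel_measurable_real by blast
  have ae': "AE z in lebesgue. indicator S z * c z = b z" by (rule AE_completion[OF ae])
  have mb: "b \<in> borel_measurable lebesgue" by (rule measurable_completion) simp
  have "integrable lebesgue b"
    using integrable_cong_AE[OF mc mb ae'] ic by simp
  then have "integrable lborel b" by (simp add: integrable_completion)
  moreover have "(\<integral>z. c z * g z \<partial>lebesgue_on S) = (\<integral>z. b z * g z \<partial>lborel)"
    if g[measurable]: "g \<in> borel_measurable borel" for g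
  proof -
    have mg: "g \<in> borel_measurable lebesgue" by (rule measurable_completion) simp
    have "(\<integral>z. c z * g z \<partial>lebesgue_on S) = (\<integral>z. (indicator S z * c z) * g z \<partial>lebesgue)"
      by (simp add: integral_restrict_space mult.assoc)
    also have "\<dots> = (\<integral>z. b z * g z \<partial>lebesgue)"
      using ae' by (intro integral_cong_AE borel_measurable_times mc mb mg) auto
    also have "\<dots> = (\<integral>z. b z * g z \<partial>lborel)"
      by (rule integral_completion) simp
    finally show ?thesis .
  qed
  ultimately show thesis using that ae by blast
qed

lemma sets_per_box [measurable]: "per_box x y \<in> sets borel"
proof -
  have "Measurable.pred borel (\<lambda>t. t \<in> per_box x y)" by measurable
  then show ?thesis by (simp add: pred_def)
qed

text \<open>The boxes are sections of one jointly measurable set, so their measure depends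
  measurably on the corners.\<close>

lemma measurable_measure_per_box:
  "(\<lambda>z. measure lebesgue (per_box (fst z) (snd z))) \<in>
    borel_measurable (borel :: ((real ^ 'd::finite) \<times> (real ^ 'd)) measure)"
proof -
  have "Measurable.pred ((borel \<Otimes>\<^sub>M borel) \<Otimes>\<^sub>M borel)
      (\<lambda>w :: ((real ^ 'd) \<times> (real ^ 'd)) \<times> (real ^ 'd). snd w \<in> per_box (fst (fst w)) (snd (fst w)))"
    by measurable
  then have "{w \<in> space (borel \<Otimes>\<^sub>M lborel). snd w \<in> per_box (fst (fst w)) (snd (fst w))}
      \<in> sets (borel \<Otimes>\<^sub>M (lborel :: (real ^ 'd) measure))"
    unfolding pred_def
    by (simp only: borel_prod space_pair_measure space_borel space_lborel UNIV_Times_UNIV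
        sets_pair_measure_cong[OF refl sets_lborel])
  then have "(\<lambda>z :: (real ^ 'd) \<times> (real ^ 'd). measure lborel (per_box (fst z) (snd z))) \<in> borel_measurable borel"
    by (rule lborel.measurable_measure[rotated]) simp
  then show ?thesis by simp
qed

lemma measurable_indicator_per_box:
  "(\<lambda>z. indicator (per_box (fst z) (snd z)) t :: real) \<in>
    borel_measurable (borel :: ((real ^ 'd::finite) \<times> (real ^ 'd)) measure)"
proof -
  have "(\<lambda>z :: (real ^ 'd) \<times> (real ^ 'd). indicator (per_box (fst z) (snd z)) t :: real)
      \<in> borel_measurable (borel \<Otimes>\<^sub>M borel)"
    by measurable
  then show ?thesis by (simp only: borel_prod)
qed

text \<open>Exchange the integrals over \<open>t\<close> and \<open>z\<close>: the inner integral of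
  the indicator over \<open>t\<close> is the measure of the box.\<close>

lemma integral_T_per:
  fixes c :: "(real ^ 'd::finite) \<times> (real ^ 'd) \<Rightarrow> real"
  assumes c: "integrable double_cube_measure c"
  shows "(\<integral>t. T_per c t \<partial>cube_measure) =
    (\<integral>z. c z * measure lebesgue (per_box (fst z) (snd z)) \<partial>double_cube_measure)"
proof -
  obtain b where ib: "integrable lborel b"
    and ae: "AE z in lborel. indicator (unit_cube \<times> unit_cube) z * c z = b z"
    and eq: "\<And>g. g \<in> borel_measurable borel \<Longrightarrow>
      (\<integral>z. c z * g z \<partial>double_cube_measure) = (\<integral>z. b z * g z \<partial>lborel)"
    by (rule borel_representative[OF double_cube_sets c]) blast
  have [measurable]: "b \<in> borel_measurable borel" using ib by auto
  define B :: "(real ^ 'd) \<times> (real ^ 'd) \<Rightarrow> (real ^ 'd) set" where "B z = per_box (fst z) (snd z)" for z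
  have mB: "Measurable.pred (borel \<Otimes>\<^sub>M (borel \<Otimes>\<^sub>M borel)) (\<lambda>w. fst w \<in> B (snd w))"
    unfolding B_def by measurable
  have [measurable]: "Measurable.pred (borel \<Otimes>\<^sub>M borel) (\<lambda>w. fst w \<in> B (snd w))"
    using mB by (simp only: borel_prod)
  \<comment> \<open>For fixed \<open>t\<close> the indicator is Borel in \<open>z\<close>, so
    replacing \<open>c\<close> by \<open>b\<close> is exact at every \<open>t\<close>, not only at
    almost every one.\<close>
  have T: "T_per c t = (\<integral>z. b z * indicator (B z) t \<partial>lborel)" for t
    unfolding T_per_def by (simp add: eq measurable_indicator_per_box B_def)
  \<comment> \<open>The cutoff in \<open>t\<close> supplies the majorant
    \<open>indicator unit_cube t * \<bar>b z\<bar>\<close>, a product of integrable functions of one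
    variable each.\<close>
  define h where "h t z = indicator unit_cube t * (b z * indicator (B z) t)" for t z
  have [measurable]: "case_prod h \<in> borel_measurable (borel \<Otimes>\<^sub>M borel)"
    unfolding h_def by measurable
  have Tm: "T_per c \<in> borel_measurable borel"
  proof -
    have "(\<lambda>(t, z). b z * indicator (B z) t) \<in> borel_measurable (borel \<Otimes>\<^sub>M borel)" by measurable
    then show ?thesis
      unfolding T[abs_def]
      using lborel.borel_measurable_lebesgue_integral[of "\<lambda>t z. b z * indicator (B z) t" borel] by simp
  qed
  have ih: "integrable (lborel \<Otimes>\<^sub>M lborel) (case_prod h)"
  proof (rule Bochner_Integration.integrable_bound)
    have "integrable lborel (\<lambda>t. indicator unit_cube t :: real)"
      using emeasure_unit_cube_finite by (auto intro!: integrable_real_indicator)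
    then show "integrable (lborel \<Otimes>\<^sub>M lborel) (\<lambda>(t, z). indicator (unit_cube :: (real ^ 'd) set) t * \<bar>b z\<bar>)"
      using ib
      by (subst lborel_pair.Fubini_integrable) auto
    show "AE w in lborel \<Otimes>\<^sub>M lborel. norm (case_prod h w) \<le>
        norm (case w of (t, z) \<Rightarrow> indicator (unit_cube :: (real ^ 'd) set) t * \<bar>b z\<bar>)"
      by (auto simp: h_def split: split_indicator)
  qed simp
  have "(\<integral>t. T_per c t \<partial>cube_measure) = (\<integral>t. \<integral>z. h t z \<partial>lborel \<partial>lborel)"
    by (subst integral_lebesgue_on_borel[OF sets_unit_cube Tm]) (simp add: T h_def[abs_def])
  also have "\<dots> = (\<integral>z. \<integral>t. h t z \<partial>lborel \<partial>lborel)"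
    using lborel_pair.Fubini_integral[OF ih] by simp
  also have "\<dots> = (\<integral>z. b z * measure lebesgue (B z) \<partial>lborel)"
  proof (rule integral_cong_AE)
    \<comment> \<open>For corners in the cube the box lies in the cube, so the cutoff in
      \<open>t\<close> changes nothing. Elsewhere the assumption on \<open>z\<close> gives
      \<open>b z = 0\<close>, and both sides vanish.\<close>
    have "(\<integral>t. h t z \<partial>lborel) = b z * measure lebesgue (B z)"
      if "indicator (unit_cube \<times> unit_cube) z * c z = b z" for z
    proof (cases "z \<in> unit_cube \<times> unit_cube")
      case True
      then have "B z \<subseteq> unit_cube"
        unfolding B_def by (intro per_box_subset_unit_cube) auto
      then have "h t z = b z * indicator (B z) t" for t
        by (auto simp: h_def split: split_indicator)
      then show ?thesis by (simp add: B_def)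
    next
      case False
      then show ?thesis using that by (simp add: h_def)
    qed
    with ae show "AE z in lborel. (\<integral>t. h t z \<partial>lborel) = b z * measure lebesgue (B z)"
      by auto
    show "(\<lambda>z. b z * measure lebesgue (B z)) \<in> borel_measurable lborel"
      unfolding B_def measurable_lborel2
      by (intro borel_measurable_times measurable_measure_per_box) measurable
  qed auto
  also have "\<dots> = (\<integral>z. c z * measure lebesgue (B z) \<partial>double_cube_measure)"
    unfolding B_def by (rule eq[symmetric, OF measurable_measure_per_box])
  finally show ?thesis by (simp add: B_def)
qed

lemma borel_measurable_lebesgue_onI:
  fixes f :: "'a::euclidean_space \<Rightarrow> 'b::topological_space"
  assumes "f \<in> borel_measurable borel"
  shows "f \<in> borel_measurable (lebesgue_on S)"
  using assms by (intro measurable_restrict_space1 measurable_completion) simp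

section \<open>Quadrature error and discrepancy\<close>

lemma measurable_local_discrepancy:
  fixes x :: "nat \<Rightarrow> real ^ 'd::finite"
  shows "(\<lambda>z. local_discrepancy N x a (per_box (fst z) (snd z))) \<in> borel_measurable double_cube_measure"
  unfolding local_discrepancy_def
  by (intro borel_measurable_lebesgue_onI borel_measurable_diff borel_measurable_sum
      borel_measurable_times borel_measurable_const measurable_indicator_per_box
      measurable_measure_per_box)

text \<open>A crude bound: only its independence of the corners matters, since a bounded measurable
  function lies in every \<open>L_p\<close> over the finite measure of the double cube.\<close>

lemma local_discrepancy_bounded:
  fixes x :: "nat \<Rightarrow> real ^ 'd::finite"
  assumes "z \<in> unit_cube \<times> unit_cube"
  shows "\<bar>local_discrepancy N x a (per_box (fst z) (snd z))\<bar> \<le>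
    (\<Sum>k=1..N. \<bar>a k\<bar>) + measure lborel (unit_cube :: (real ^ 'd) set)"
proof -
  have "\<bar>\<Sum>k=1..N. a k * indicator (per_box (fst z) (snd z)) (x k)\<bar> \<le> (\<Sum>k=1..N. \<bar>a k\<bar>)"
    by (rule order_trans[OF sum_abs sum_mono]) (simp add: abs_mult indicator_def)
  moreover have "per_box (fst z) (snd z) \<subseteq> unit_cube"
    using assms by (intro per_box_subset_unit_cube) auto
  then have "measure lborel (per_box (fst z) (snd z)) \<le> measure lborel (unit_cube :: (real ^ 'd) set)"
    using emeasure_unit_cube_finite[where 'd='d]
    by (intro measure_mono_fmeasurable fmeasurableI) auto
  ultimately show ?thesis
    unfolding local_discrepancy_def using measure_nonneg[of lebesgue "per_box (fst z) (snd z)"]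
    by (simp only: measure_completion sets_per_box sets_lborel)
qed

lemma local_discrepancy_Lp_space:
  fixes x :: "nat \<Rightarrow> real ^ 'd::finite"
  assumes "1 \<le> p"
  shows "(\<lambda>z. local_discrepancy N x a (per_box (fst z) (snd z))) \<in> Lp_space p double_cube_measure"
  by (rule finite_measure.bounded_Lp_space[OF finite_measure_double_cube assms
        measurable_local_discrepancy local_discrepancy_bounded]) simp

text \<open>Both terms are pairings with \<open>c\<close>: the integral with the measure of the box,
  by Fubini, and the value at \<open>x k\<close> with the indicator at \<open>x k\<close>, by
  definition. The sign appears because the discrepancy is the sum minus the measure.\<close>

lemma quadrature_error_T_per:
  fixes c :: "(real ^ 'd::finite) \<times> (real ^ 'd) \<Rightarrow> real"
  assumes c: "integrable double_cube_measure c"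
  shows "(\<integral>t. T_per c t \<partial>cube_measure) - quadrature N x a (T_per c) =
    - (\<integral>z. c z * local_discrepancy N x a (per_box (fst z) (snd z)) \<partial>double_cube_measure)"
proof -
  let ?M = "double_cube_measure :: ((real ^ 'd) \<times> (real ^ 'd)) measure"
  let ?B = "\<lambda>z :: (real ^ 'd) \<times> (real ^ 'd). per_box (fst z) (snd z)"
  have bounded: "integrable ?M (\<lambda>z. c z * g z)"
    if "g \<in> borel_measurable borel" "\<And>z. z \<in> unit_cube \<times> unit_cube \<Longrightarrow> \<bar>g z\<bar> \<le> K" for g K
  proof (rule Bochner_Integration.integrable_bound)
    show "integrable ?M (\<lambda>z. c z * K)" using c by simp
    show "(\<lambda>z. c z * g z) \<in> borel_measurable ?M"
      by (intro borel_measurable_times borel_measurable_integrable[OF c]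
          borel_measurable_lebesgue_onI that(1))
    show "AE z in ?M. norm (c z * g z) \<le> norm (c z * K)"
      using that(2) by (intro AE_I2) (fastforce simp: abs_mult intro!: mult_left_mono)
  qed
  have ind: "integrable ?M (\<lambda>z. c z * indicator (?B z) (x k))" for k
    by (rule bounded[where K=1, OF measurable_indicator_per_box]) simp
  \<comment> \<open>With \<open>N = 0\<close> the sum is empty, and the bound on the discrepancy
    becomes one on the measure of the box.\<close>
  have meas: "integrable ?M (\<lambda>z. c z * measure lebesgue (?B z))"
    using local_discrepancy_bounded[of _ 0]
    by (intro bounded[OF measurable_measure_per_box]) (simp add: local_discrepancy_def)
  have "quadrature N x a (T_per c) = (\<Sum>k=1..N. \<integral>z. a k * (c z * indicator (?B z) (x k)) \<partial>?M)"
    by (simp add: quadrature_def T_per_def)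
  also have "\<dots> = (\<integral>z. (\<Sum>k=1..N. a k * (c z * indicator (?B z) (x k))) \<partial>?M)"
    using ind by (subst Bochner_Integration.integral_sum) auto
  finally have "(\<integral>t. T_per c t \<partial>cube_measure) - quadrature N x a (T_per c) =
      (\<integral>z. c z * measure lebesgue (?B z) - (\<Sum>k=1..N. a k * (c z * indicator (?B z) (x k))) \<partial>?M)"
    using ind meas integral_T_per[OF c] by (subst Bochner_Integration.integral_diff) auto
  also have "\<dots> = (\<integral>z. - (c z * local_discrepancy N x a (?B z)) \<partial>?M)"
    by (intro Bochner_Integration.integral_cong)
      (simp_all only: local_discrepancy_def sum_distrib_left right_diff_distrib mult.left_commute
        minus_diff_eq)
  finally show ?thesis by simp
qed

text \<open>The upper bound has to use all representations \<open>f = T_per c\<close>, as the norm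
  of \<open>f\<close> is an infimum over them; for the lower bound one representation suffices,
  since the norm of \<open>T_per c\<close> is at most that of \<open>c\<close>.\<close>

lemma worst_case_error_eq_per_discrepancy:
  fixes x :: "nat \<Rightarrow> real ^ 'd::finite"
  assumes pq: "1 \<le> p" "1 \<le> q" "1 / p + 1 / q = 1"
  shows "worst_case_error q N x a = per_discrepancy p N x a"
proof -
  let ?M = "double_cube_measure :: ((real ^ 'd) \<times> (real ^ 'd)) measure"
  interpret finite_measure ?M by (rule finite_measure_double_cube)
  have qp: "1 / q + 1 / p = 1" using pq(3) by (simp add: add.commute)
  define g where "g = (\<lambda>z. local_discrepancy N x a (per_box (fst z) (snd z)))"
  have g: "g \<in> Lp_space p ?M"
    unfolding g_def by (rule local_discrepancy_Lp_space[OF pq(1)])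
  have disc: "per_discrepancy p N x a = Lp_norm p ?M g"
    by (simp add: per_discrepancy_def g_def split_beta')
  have error: "\<bar>(\<integral>t. T_per c t \<partial>cube_measure) - quadrature N x a (T_per c)\<bar> = \<bar>\<integral>z. c z * g z \<partial>?M\<bar>"
    if "c \<in> Lp_space q ?M" for c
    using quadrature_error_T_per[OF Lp_space_integrable[OF pq(2,1) qp that], of N x a]
    by (simp add: g_def)
  show ?thesis
  proof (rule antisym)
    show "worst_case_error q N x a \<le> per_discrepancy p N x a"
      unfolding worst_case_error_def
    proof (rule SUP_least, safe)
      fix f :: "real ^ 'd \<Rightarrow> real"
      assume f: "f \<in> F_per q" "F_per_norm q f \<le> 1"
      let ?C = "{c \<in> Lp_space q ?M. f = T_per c}"
      let ?e = "ennreal \<bar>(\<integral>t. f t \<partial>cube_measure) - quadrature N x a f\<bar>"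
      have bound: "?e \<le> Lp_norm q ?M c * Lp_norm p ?M g" if "c \<in> ?C" for c
        using that error[of c] Lp_space_Holder(2)[OF pq(2,1) qp _ g, of c] by auto
      show "?e \<le> per_discrepancy p N x a"
      \<comment> \<open>The infimum over \<open>c\<close> need not be attained, so the bound is
        first divided by the norm of \<open>g\<close>. If that norm is zero, any representation of
        \<open>f\<close> gives error zero.\<close>
      proof (cases "Lp_norm p ?M g = 0")
        case True
        then show ?thesis using bound f(1) by (force simp: F_per_def)
      next
        case False
        have finite: "Lp_norm p ?M g \<noteq> \<infinity>" using g by (auto simp: Lp_space_def)
        have "?e / Lp_norm p ?M g \<le> Lp_norm q ?M c" if "c \<in> ?C" for c
          using bound[OF that] False
          by (intro divide_le_posI_ennreal) (auto simp: mult.commute zero_less_iff_neq_zero)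
        then have "?e / Lp_norm p ?M g \<le> F_per_norm q f"
          unfolding F_per_norm_def by (rule INF_greatest)
        also have "\<dots> \<le> 1" by (rule f(2))
        finally have "?e / Lp_norm p ?M g * Lp_norm p ?M g \<le> 1 * Lp_norm p ?M g"
          by (rule mult_right_mono) simp
        then show ?thesis
          using False finite
          by (simp add: disc ennreal_divide_times ennreal_divide_self top.not_eq_extremum)
      qed
    qed
    show "per_discrepancy p N x a \<le> worst_case_error q N x a"
      unfolding disc
    \<comment> \<open>Duality supplies test functions only for values strictly below the norm; such
      values are finite, hence of the form \<open>ennreal s\<close>.\<close>
    proof (rule dense_le)
      fix r assume r: "r < Lp_norm p ?M g"
      then obtain s where s: "r = ennreal s" by (cases r) auto
      obtain c where c: "c \<in> Lp_space q ?M" "Lp_norm q ?M c \<le> 1" "s \<le> (\<integral>z. c z * g z \<partial>?M)"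
        using Lp_norm_dual[OF pq g] r s by blast
      have "F_per_norm q (T_per c) \<le> 1"
        unfolding F_per_norm_def using c(1,2) by (intro INF_lower2[of c]) auto
      moreover have "T_per c \<in> F_per q" using c(1) by (auto simp: F_per_def)
      ultimately have "ennreal \<bar>(\<integral>t. T_per c t \<partial>cube_measure) - quadrature N x a (T_per c)\<bar>
          \<le> worst_case_error q N x a"
        unfolding worst_case_error_def by (intro SUP_upper) auto
      moreover have "r \<le> ennreal \<bar>\<integral>z. c z * g z \<partial>?M\<bar>"
        using c(3) s by (auto intro: ennreal_leI)
      ultimately show "r \<le> worst_case_error q N x a"
        using error[OF c(1)] by simp
    qed
  qed
qed

theorem theorem6:
  fixes p q :: ennreal and N :: nat
  assumes "1 \<le> p" and "1 \<le> q" and "1 / p + 1 / q = 1" and "1 \<le> N"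
  shows "(\<forall>x \<in> (point_sets N :: (nat \<Rightarrow> real ^ 'd::finite) set). \<forall>a.
            worst_case_error q N x a = per_discrepancy p N x a) \<and>
         min_worst_case_error TYPE('d) q N = min_per_discrepancy TYPE('d) p N"
proof -
  \<comment> \<open>Equality as functions of points and weights makes the two minimal quantities
    infima of the same function.\<close>
  have "worst_case_error q N = (per_discrepancy p N :: (nat \<Rightarrow> real ^ 'd) \<Rightarrow> _)"
    by (intro ext worst_case_error_eq_per_discrepancy assms)
  then show ?thesis
    by (simp add: min_worst_case_error_def min_per_discrepancy_def)
qed

end
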